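(* Let $\mu\in\Delta_m$, $\nu\in\Delta_n$ have positive entries, $C\in\mathbb R^{m\times n}$, and let $(f(t),g(t))_{t\ge0}$ be the cold Sinkhorn dynamics from any initial pair $(\bar f^0,\bar g^0)\in\partial\mathcal F$, with associated $(t_\ell,\bar v^\ell,\bar w^\ell,\mathcal E^\ell)_{\ell\le L}$. Let $\Psi_0(f,g)=-f^\top\mu-g^\top\nu$. Then $t\mapsto\Psi_0(f(t),g(t))$ is non-increasing, and for all $\ell\le L$ and $t\in[t_\ell,t_{\ell+1})$, $$\frac{d}{dt}\Psi_0(f(t),g(t))=-H(\mu|\mu^*(\mathcal E^\ell))-H(\nu|\nu^*(\mathcal E^\ell))=-H(\mu^*(\mathcal E^\ell)|\mu)-H(\nu^*(\mathcal E^\ell)|\nu)$$ (at $t=t_\ell$ the derivative is understood as the right derivative).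
   Context: $\Delta_N$ is the probability simplex in $\mathbb R^N$; $H(p|q)=\sum_I p_I\log(p_I/q_I)$ is relative entropy. **Dual OT polytope.** $\mathcal F=\{(f,g)\in\mathbb R^m\times\mathbb R^n:\ f_i+g_j\le C_{ij}\ \forall i,j\}$; $\partial\mathcal F$ is its Pareto frontier: the set of $(f,g)\in\mathcal F$ such that the only $(f',g')\in\mathcal F$ with $f'_i\ge f_i$ and $g'_j\ge g_j$ for all $i,j$ is $(f,g)$ itself. **The vectors $v^*(\mathcal E),w^*(\mathcal E)$.** For $\mathcal E\subset\{1,\dots,m\}\times\{1,\dots,n\}$, $\Delta_{\mathcal E}$ is the set of probability distributions on $\mathcal E$; for $\pi\in\Delta_{\mathcal E}$, $(X_\sharp\pi)_i=\sum_{j:(i,j)\in\mathcal E}\pi_{ij}$ and $(Y_\sharp\pi)_j=\sum_{i:(i,j)\in\mathcal E}\pi_{ij}$. If the bipartite graph on $\{1,\dots,m\}\sqcup\{1,\dots,n\}$ with edge set $\mathcal E$ has no isolated vertex, let $\mu^*(\mathcal E)$ be the minimizer of $H(\bar\mu|\mu)$ over $\bar\mu$ such that there is $Q\in\Delta_{\mathcal E}$ with $X_\sharp Q=\bar\mu$, $Y_\sharp Q=\nu$; let $\nu^*(\mathcal E)$ be the minimizer of $H(\bar\nu|\nu)$ over $\bar\nu$ such that there is $P\in\Delta_{\mathcal E}$ with $X_\sharp P=\mu$, $Y_\sharp P=\bar\nu$; and $v^*(\mathcal E)_i=\log(\mu_i/\mu^*_i(\mathcal E))$, $w^*(\mathcal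 E)_j=\log(\nu_j/\nu^*_j(\mathcal E))$. **Cold Sinkhorn dynamics.** For $(\bar f^0,\bar g^0)\in\partial\mathcal F$, it is the continuous curve with $f(0)=\bar f^0$, $g(0)=\bar g^0$ and $\frac{d}{dt}f(t)=\bar v^\ell$, $\frac{d}{dt}g(t)=\bar w^\ell$ for $t\in[t_\ell,t_{\ell+1})$, $\ell\le L$, where $(t_\ell,\bar v^\ell,\bar w^\ell,\mathcal E^\ell)_{\ell\le L}$ is defined recursively: $t_0=0$, $\mathcal E^0=\{(i,j):\bar f^0_i+\bar g^0_j-C_{ij}=0\}$, $\bar v^0=v^*(\mathcal E^0)$, $\bar w^0=w^*(\mathcal E^0)$; and for $\ell\ge0$, $$t_{\ell+1}=\inf\Big\{t\ge t_\ell:\ \max_{(i,j)\notin\mathcal E^\ell} f_i(t_\ell)+g_j(t_\ell)+(t-t_\ell)(\bar v^\ell_i+\bar w^\ell_j)-C_{ij}\ge0\Big\}.$$ If $t_{\ell+1}<\infty$, then $\mathcal E^{\ell+1}=\{(i,j): f_i(t_\ell)+g_j(t_\ell)+(t_{\ell+1}-t_\ell)(\bar v^\ell_i+\bar w^\ell_j)-C_{ij}=0\}$, $\bar v^{\ell+1}=v^*(\mathcal E^{\ell+1})$, $\bar w^{\ell+1}=w^*(\mathcal E^{\ell+1})$. If $t_{\ell+1}=\infty$, then $L=\ell$ and the sequence stops. Set $t_{L+1}=\infty$. (All the sets $\mathcal E^\ell$ arising have no isolated vertex.) *)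

theory Defs
  imports "HOL-Analysis.Analysis"
begin

definition prob_simplex :: "(real ^ 'k::finite) set" where
  "prob_simplex = {p. (\<forall>i. 0 \<le> p $ i) \<and> (\<Sum>i\<in>UNIV. p $ i) = 1}"

text \<open>
  The convention \<open>0 log 0 = 0\<close> is built in since \<open>0 * ln 0 = 0\<close>. The sum agrees with relative
  entropy only where \<open>q\<close> is positive: a term with \<open>p $ i > 0\<close> and \<open>q $ i = 0\<close>
  evaluates to \<open>0\<close> instead of infinity. Below, \<open>q\<close> is always \<open>\<mu>\<close>, \<open>\<nu>\<close> or one of the
  minimizers, which are positive when \<open>\<mu>\<close> and \<open>\<nu>\<close> are and \<open>E\<close> has no isolated vertex.
\<close>
definition rel_entropy :: "real ^ 'k::finite \<Rightarrow> real ^ 'k \<Rightarrow> real" where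
  "rel_entropy p q = (\<Sum>i\<in>UNIV. p $ i * ln (p $ i / q $ i))"

definition dual_feasible ::
  "real ^ 'n ^ 'm \<Rightarrow> ((real ^ 'm::finite) \<times> (real ^ 'n::finite)) set" where
  "dual_feasible C = {(f, g). \<forall>i j. f $ i + g $ j \<le> C $ i $ j}"

definition pareto_frontier ::
  "real ^ 'n ^ 'm \<Rightarrow> ((real ^ 'm::finite) \<times> (real ^ 'n::finite)) set" where
  "pareto_frontier C = {(f, g). (f, g) \<in> dual_feasible C \<and>
     (\<forall>f' g'. (f', g') \<in> dual_feasible C \<and> (\<forall>i. f $ i \<le> f' $ i) \<and> (\<forall>j. g $ j \<le> g' $ j)
        \<longrightarrow> (f', g') = (f, g))}"

text \<open>Distributions on \<open>E\<close> are represented by functions on all pairs that vanish outside \<open>E\<close>.\<close>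
definition edge_simplex :: "('m::finite \<times> 'n::finite) set \<Rightarrow> ('m \<times> 'n \<Rightarrow> real) set" where
  "edge_simplex E = {\<pi>. (\<forall>e. 0 \<le> \<pi> e) \<and> (\<forall>e. e \<notin> E \<longrightarrow> \<pi> e = 0) \<and> (\<Sum>e\<in>E. \<pi> e) = 1}"

definition X_marginal ::
  "('m::finite \<times> 'n::finite) set \<Rightarrow> ('m \<times> 'n \<Rightarrow> real) \<Rightarrow> real ^ 'm" where
  "X_marginal E \<pi> = (\<chi> i. \<Sum>j | (i, j) \<in> E. \<pi> (i, j))"

definition Y_marginal ::
  "('m::finite \<times> 'n::finite) set \<Rightarrow> ('m \<times> 'n \<Rightarrow> real) \<Rightarrow> real ^ 'n" where
  "Y_marginal E \<pi> = (\<chi> j. \<Sum>i | (i, j) \<in> E. \<pi> (i, j))"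

text \<open>
  Compactness and strict convexity give existence and uniqueness of both minimizers when \<open>E\<close>
  has no isolated vertex; only then do the next four definitions carry meaning.
\<close>
definition mu_star ::
  "real ^ 'm \<Rightarrow> real ^ 'n \<Rightarrow> ('m::finite \<times> 'n::finite) set \<Rightarrow> real ^ 'm" where
  "mu_star \<mu> \<nu> E = (THE p. is_arg_min (\<lambda>p. rel_entropy p \<mu>)
     (\<lambda>p. \<exists>Q\<in>edge_simplex E. X_marginal E Q = p \<and> Y_marginal E Q = \<nu>) p)"

definition nu_star ::
  "real ^ 'm \<Rightarrow> real ^ 'n \<Rightarrow> ('m::finite \<times> 'n::finite) set \<Rightarrow> real ^ 'n" where
  "nu_star \<mu> \<nu> E = (THE q. is_arg_min (\<lambda>q. rel_entropy q \<nu>)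
     (\<lambda>q. \<exists>P\<in>edge_simplex E. X_marginal E P = \<mu> \<and> Y_marginal E P = q) q)"

definition v_star ::
  "real ^ 'm \<Rightarrow> real ^ 'n \<Rightarrow> ('m::finite \<times> 'n::finite) set \<Rightarrow> real ^ 'm" where
  "v_star \<mu> \<nu> E = (\<chi> i. ln (\<mu> $ i / mu_star \<mu> \<nu> E $ i))"

definition w_star ::
  "real ^ 'm \<Rightarrow> real ^ 'n \<Rightarrow> ('m::finite \<times> 'n::finite) set \<Rightarrow> real ^ 'n" where
  "w_star \<mu> \<nu> E = (\<chi> j. ln (\<nu> $ j / nu_star \<mu> \<nu> E $ j))"

text \<open>
  First time from \<open>s\<close> on at which the line through \<open>(f, g)\<close> with velocity \<open>(v, w)\<close>
  meets a constraint outside \<open>E\<close>. The supremum is over a finite set, hence a maximum, and is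
  \<open>-\<infinity>\<close> if no pair lies outside \<open>E\<close>; the infimum of the empty set is \<open>\<infinity>\<close>.
\<close>
definition hitting_time ::
  "real ^ 'n ^ 'm \<Rightarrow> ('m::finite \<times> 'n::finite) set \<Rightarrow> real \<Rightarrow>
    real ^ 'm \<Rightarrow> real ^ 'n \<Rightarrow> real ^ 'm \<Rightarrow> real ^ 'n \<Rightarrow> ereal" where
  "hitting_time C E s f g v w =
     (INF r\<in>{r. s \<le> r \<and>
        0 \<le> (SUP (i, j)\<in>- E. ereal (f $ i + g $ j + (r - s) * (v $ i + w $ j) - C $ i $ j))}.
      ereal r)"

text \<open>
  \<open>(f, g)\<close> is the cold Sinkhorn curve started at \<open>(f0, g0)\<close>, with data \<open>(t l, v l, w l, E l)\<close>
  for \<open>l \<le> L\<close>; entries with larger index are irrelevant, except that \<open>t (L + 1) = \<infinity>\<close>.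
  Termination of the recursion is not built in: \<open>L = \<infinity>\<close> is allowed. Within the half-line
  starting at \<open>t l\<close>, the derivative is one-sided at \<open>t l\<close> and two-sided afterwards.
\<close>
definition cold_sinkhorn ::
  "real ^ 'm \<Rightarrow> real ^ 'n \<Rightarrow> real ^ 'n ^ 'm \<Rightarrow> real ^ 'm \<Rightarrow> real ^ 'n \<Rightarrow>
    (real \<Rightarrow> real ^ 'm) \<Rightarrow> (real \<Rightarrow> real ^ 'n) \<Rightarrow>
    enat \<Rightarrow> (nat \<Rightarrow> ereal) \<Rightarrow> (nat \<Rightarrow> real ^ 'm) \<Rightarrow> (nat \<Rightarrow> real ^ 'n) \<Rightarrow>
    (nat \<Rightarrow> ('m::finite \<times> 'n::finite) set) \<Rightarrow> bool" where
  "cold_sinkhorn \<mu> \<nu> C f0 g0 f g L t v w E \<longleftrightarrow>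
     continuous_on {0..} f \<and> continuous_on {0..} g \<and> f 0 = f0 \<and> g 0 = g0 \<and>
     t 0 = 0 \<and> E 0 = {(i, j). f0 $ i + g0 $ j - C $ i $ j = 0} \<and>
     (\<forall>l. enat l \<le> L \<longrightarrow>
        (let s = real_of_ereal (t l); s' = real_of_ereal (t (Suc l)) in
          v l = v_star \<mu> \<nu> (E l) \<and> w l = w_star \<mu> \<nu> (E l) \<and>
          t (Suc l) = hitting_time C (E l) s (f s) (g s) (v l) (w l) \<and>
          (t (Suc l) < \<infinity> \<longrightarrow> enat l < L \<and>
             E (Suc l) = {(i, j). f s $ i + g s $ j + (s' - s) * (v l $ i + w l $ j) - C $ i $ j = 0}) \<and>
          (t (Suc l) = \<infinity> \<longrightarrow> L = enat l) \<and>
          (\<forall>r. t l \<le> ereal r \<and> ereal r < t (Suc l) \<longrightarrow>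
             (f has_vector_derivative v l) (at r within {s..}) \<and>
             (g has_vector_derivative w l) (at r within {s..}))))"

definition Psi0 ::
  "real ^ 'm::finite \<Rightarrow> real ^ 'n::finite \<Rightarrow> real ^ 'm \<Rightarrow> real ^ 'n \<Rightarrow> real" where
  "Psi0 \<mu> \<nu> f g = - (f \<bullet> \<mu>) - g \<bullet> \<nu>"

end

theory Submission imports Defs "HOL-Real_Asymp.Real_Asymp"
begin

text \<open>
  On a phase with edge set \<open>E\<close>, the functional has slope \<open>- (v \<bullet> \<mu>) - w \<bullet> \<nu>\<close>, where
  \<open>v = ln (\<mu> / \<mu>\<^sup>*)\<close> and \<open>w = ln (\<nu> / \<nu>\<^sup>*)\<close>. This is by definition minus the sum of the entropies of \<open>\<mu>\<close> and \<open>\<nu>\<close>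
  relative to \<open>\<mu>\<^sup>*\<close> and \<open>\<nu>\<^sup>*\<close>. What has to be understood is how the two minimization problems interact.

  The optimality conditions of the first problem say that its optimal flow \<open>Q\<close> serves each column only from rows
  where \<open>v\<close> is maximal among the neighbours (lemma \<open>optimal_flow_ratio_mono\<close>). Let \<open>- w j\<close> be this maximum.
  Then \<open>v i + w j \<le> 0\<close> on \<open>E\<close>, with equality where \<open>Q\<close> has mass. The flow \<open>Q (i, j) * exp (v i)\<close> has the
  marginals required in the second problem and satisfies its optimality conditions, so this \<open>w\<close> is the same as above:
  a single certificate \<open>(v, w, Q)\<close> solves both problems (\<open>optimal_slopes\<close>, \<open>mu_star_eq\<close>, \<open>nu_star_eq\<close>).
  Integrating \<open>v i = - w j\<close> against \<open>Q\<close> gives \<open>H(\<mu>\<^sup>*|\<mu>) = H(\<nu>|\<nu>\<^sup>*)\<close>, and symmetrically \<open>H(\<nu>\<^sup>*|\<nu>) = H(\<mu>|\<mu>\<^sup>*)\<close>,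
  which is the second formula for the slope (\<open>optimal_slopes_entropies\<close>).

  Two things remain for the monotonicity. First, no vertex may become isolated: edges that carry mass stay
  tight during the phase and meet every vertex. Second, the phases must exhaust the half-line. At the end of a phase a
  new edge with \<open>v i + w j > 0\<close> appears, while the edges carrying mass are kept. As the certificate needs only these
  edges, the rate \<open>v \<bullet> \<mu> + w \<bullet> \<nu>\<close>, which is up to a constant the maximum of a strictly concave function over a cone, strictly decreases
  (\<open>optimal_rate_decreases\<close>). There are finitely many edge sets, so there are finitely many phases, and the last one
  lasts forever.
\<close>

section \<open>The entropy integrand\<close>

text \<open>
  The graph of the convex function \<open>x ln (x / a)\<close> lies above its tangent at \<open>y\<close>. The point \<open>x = 0\<close>
  is included: relative entropies of arbitrary marginals are compared below, and these may vanish.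
\<close>
lemma entropy_term_tangent:
  fixes a x y :: real
  assumes "0 < a" "0 \<le> x" "0 < y"
  shows "y * ln (y / a) + (ln (y / a) + 1) * (x - y) \<le> x * ln (x / a)"
    and "x \<noteq> y \<Longrightarrow> y * ln (y / a) + (ln (y / a) + 1) * (x - y) < x * ln (x / a)"
proof -
  have "y * ln (y / a) + (ln (y / a) + 1) * (x - y) \<le> x * ln (x / a) \<and>
    (x \<noteq> y \<longrightarrow> y * ln (y / a) + (ln (y / a) + 1) * (x - y) < x * ln (x / a))"
  proof (cases "x = 0")
    case True
    then show ?thesis using assms by (simp add: algebra_simps)
  next
    case False
    with assms have x: "0 < x" by simp
    have le: "ln (y / x) \<le> y / x - 1" using x assms by (intro ln_le_minus_one) simp
    have eq: "ln (y / x) \<noteq> y / x - 1" if "x \<noteq> y"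
      using ln_eq_minus_one[of "y / x"] x assms that by auto
    have *: "y * ln (y / a) + (ln (y / a) + 1) * (x - y) - x * ln (x / a)
        = x * (ln (y / x) - (y / x - 1))"
      using x assms by (simp add: ln_div field_simps)
    have "x * (ln (y / x) - (y / x - 1)) \<le> 0"
      using x le by (intro mult_nonneg_nonpos) auto
    moreover have "x * (ln (y / x) - (y / x - 1)) < 0" if "x \<noteq> y"
      using x le eq[OF that] by (intro mult_pos_neg) auto
    ultimately show ?thesis using * by linarith
  qed
  then show "y * ln (y / a) + (ln (y / a) + 1) * (x - y) \<le> x * ln (x / a)"
    and "x \<noteq> y \<Longrightarrow> y * ln (y / a) + (ln (y / a) + 1) * (x - y) < x * ln (x / a)" by auto
qed

lemma entropy_term_continuous:
  fixes a :: real
  assumes "0 < a"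
  shows "continuous_on {0..} (\<lambda>x. x * ln (x / a))"
proof -
  have "((\<lambda>x. x * ln (x / a)) \<longlongrightarrow> y * ln (y / a)) (at y within {0..})" if "0 \<le> y" for y
  proof (cases "y = 0")
    case True
    have "((\<lambda>x. x * ln (x / a)) \<longlongrightarrow> 0) (at_right 0)"
      using assms by real_asymp
    then show ?thesis using True by (simp add: at_within_Ici_at_right)
  next
    case False
    with that have "isCont (\<lambda>x. x * ln (x / a)) y" using assms by (intro continuous_intros) auto
    then show ?thesis by (auto simp: isCont_def intro: tendsto_mono at_le)
  qed
  then show ?thesis by (simp add: continuous_on_def)
qed

section \<open>Flows with prescribed column sums\<close>

definition no_isolated_vertex :: "('m \<times> 'n) set \<Rightarrow> bool" where
  "no_isolated_vertex E \<longleftrightarrow> (\<forall>i. \<exists>j. (i, j) \<in> E) \<and> (\<forall>j. \<exists>i. (i, j) \<in> E)"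

definition row_sums :: "('m::finite \<times> 'n::finite \<Rightarrow> real) \<Rightarrow> real ^ 'm" where
  "row_sums Q = (\<chi> i. \<Sum>j\<in>UNIV. Q (i, j))"

definition flows :: "real ^ 'n \<Rightarrow> ('m::finite \<times> 'n::finite) set \<Rightarrow> ('m \<times> 'n \<Rightarrow> real) set" where
  "flows \<nu> E = {Q. (\<forall>e. 0 \<le> Q e) \<and> (\<forall>e. e \<notin> E \<longrightarrow> Q e = 0) \<and> (\<forall>j. (\<Sum>i\<in>UNIV. Q (i, j)) = \<nu> $ j)}"

lemma flows_nonneg: "Q \<in> flows \<nu> E \<Longrightarrow> 0 \<le> Q e"
  by (simp add: flows_def del: split_paired_All)

lemma flows_support: "Q \<in> flows \<nu> E \<Longrightarrow> Q e \<noteq> 0 \<Longrightarrow> e \<in> E"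
  by (auto simp: flows_def simp del: split_paired_All)

lemma X_marginal_eq_row_sums:
  assumes "\<forall>e. e \<notin> E \<longrightarrow> Q e = 0"
  shows "X_marginal E Q = row_sums Q"
  unfolding X_marginal_def row_sums_def vec_eq_iff
  using assms by (auto intro!: sum.mono_neutral_left)

lemma Y_marginal_eq_column_sums:
  assumes "\<forall>e. e \<notin> E \<longrightarrow> Q e = 0"
  shows "Y_marginal E Q = (\<chi> j. \<Sum>i\<in>UNIV. Q (i, j))"
  unfolding Y_marginal_def vec_eq_iff
  using assms by (auto intro!: sum.mono_neutral_left)

lemma sum_pairs_iterated:
  fixes Q :: "'m::finite \<times> 'n::finite \<Rightarrow> real"
  shows "sum Q UNIV = (\<Sum>i\<in>UNIV. \<Sum>j\<in>UNIV. Q (i, j))"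
    and "sum Q UNIV = (\<Sum>j\<in>UNIV. \<Sum>i\<in>UNIV. Q (i, j))"
proof -
  show 1: "sum Q UNIV = (\<Sum>i\<in>UNIV. \<Sum>j\<in>UNIV. Q (i, j))"
    using sum.cartesian_product[of "\<lambda>i j. Q (i, j)" UNIV UNIV] by simp
  show "sum Q UNIV = (\<Sum>j\<in>UNIV. \<Sum>i\<in>UNIV. Q (i, j))"
    unfolding 1 by (rule sum.swap)
qed

lemma flows_iff_edge_simplex:
  fixes \<nu> :: "real ^ 'n::finite" and E :: "('m::finite \<times> 'n) set"
  assumes "\<nu> \<in> prob_simplex"
  shows "(Q \<in> edge_simplex E \<and> Y_marginal E Q = \<nu>) \<longleftrightarrow> Q \<in> flows \<nu> E"
proof (cases "\<forall>e. e \<notin> E \<longrightarrow> Q e = 0")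
  case True
  have "sum Q E = sum Q UNIV" using True by (intro sum.mono_neutral_left) auto
  also have "\<dots> = (\<Sum>j\<in>UNIV. \<Sum>i\<in>UNIV. Q (i, j))" by (rule sum_pairs_iterated)
  finally show ?thesis
    using assms True
    by (auto simp: edge_simplex_def flows_def Y_marginal_eq_column_sums vec_eq_iff prob_simplex_def)
next
  case False
  then show ?thesis by (auto simp: edge_simplex_def flows_def)
qed

lemma mu_star_eq_flows:
  assumes "\<nu> \<in> prob_simplex"
  shows "mu_star \<mu> \<nu> E = (THE p. is_arg_min (\<lambda>p. rel_entropy p \<mu>) (\<lambda>p. p \<in> row_sums ` flows \<nu> E) p)"
proof -
  have "(\<exists>Q\<in>edge_simplex E. X_marginal E Q = p \<and> Y_marginal E Q = \<nu>) \<longleftrightarrow> p \<in> row_sums ` flows \<nu> E" for p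
  proof -
    have "X_marginal E Q = row_sums Q" if "Q \<in> edge_simplex E" for Q
      using that by (intro X_marginal_eq_row_sums) (simp add: edge_simplex_def)
    then show ?thesis
      using flows_iff_edge_simplex[OF assms, of _ E] by (auto simp: image_iff)
  qed
  then show ?thesis by (simp add: mu_star_def)
qed

lemma nu_star_eq_mu_star_converse:
  "nu_star \<mu> \<nu> E = mu_star \<nu> \<mu> (converse E)"
proof -
  have tr: "(\<lambda>e. P (prod.swap e)) \<in> edge_simplex (converse E) \<and>
      X_marginal (converse E) (\<lambda>e. P (prod.swap e)) = Y_marginal E P \<and>
      Y_marginal (converse E) (\<lambda>e. P (prod.swap e)) = X_marginal E P"
    if "P \<in> edge_simplex E" for P and E :: "('c::finite \<times> 'd::finite) set"
  proof -
    have "(\<Sum>e\<in>converse E. P (prod.swap e)) = sum P E"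
      by (rule sum.reindex_bij_witness[of _ prod.swap prod.swap]) auto
    then show ?thesis using that
      by (auto simp: edge_simplex_def X_marginal_def Y_marginal_def)
  qed
  have "(\<exists>P\<in>edge_simplex E. X_marginal E P = \<mu> \<and> Y_marginal E P = q) \<longleftrightarrow>
    (\<exists>Q\<in>edge_simplex (converse E). X_marginal (converse E) Q = q \<and> Y_marginal (converse E) Q = \<mu>)" for q
    using tr[of _ E] tr[of _ "converse E"] by (metis converse_converse)
  then show ?thesis by (simp add: nu_star_def mu_star_def)
qed

section \<open>Entropy-minimizing flows\<close>

lemma flow_exists:
  fixes \<nu> :: "real ^ 'n::finite" and E :: "('m::finite \<times> 'n) set"
  assumes "\<forall>j. 0 < \<nu> $ j" and "no_isolated_vertex E"
  shows "flows \<nu> E \<noteq> {}"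
proof -
  \<comment> \<open>Each column spreads its mass evenly over its neighbours.\<close>
  let ?d = "\<lambda>j. real (card {i. (i, j) \<in> E})"
  let ?Q = "\<lambda>(i, j). if (i, j) \<in> E then \<nu> $ j / ?d j else 0"
  have d: "0 < ?d j" for j
    using assms(2) by (auto simp: no_isolated_vertex_def card_gt_0_iff)
  have "(\<Sum>i\<in>UNIV. ?Q (i, j)) = \<nu> $ j" for j
  proof -
    have "(\<Sum>i\<in>UNIV. ?Q (i, j)) = (\<Sum>i | (i, j) \<in> E. \<nu> $ j / ?d j)"
      by (simp add: sum.If_cases)
    also have "\<dots> = \<nu> $ j" using d[of j] by (auto simp: card_gt_0_iff)
    finally show ?thesis .
  qed
  then have "?Q \<in> flows \<nu> E"
    using assms(1) by (auto simp: flows_def less_imp_le)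
  then show ?thesis by blast
qed

text \<open>
  The entropy is continuous up to the boundary and the flows form a compact set. Compactness is
  obtained after moving from functions on pairs to the Euclidean space indexed by pairs.
\<close>
lemma optimal_flow_exists:
  fixes \<mu> :: "real ^ 'm::finite" and \<nu> :: "real ^ 'n::finite" and E :: "('m \<times> 'n) set"
  assumes "\<forall>i. 0 < \<mu> $ i" and "\<forall>j. 0 < \<nu> $ j" and "no_isolated_vertex E"
  obtains Q where "Q \<in> flows \<nu> E"
    and "\<And>Q'. Q' \<in> flows \<nu> E \<Longrightarrow> rel_entropy (row_sums Q) \<mu> \<le> rel_entropy (row_sums Q') \<mu>"
proof -
  define K :: "(real ^ ('m \<times> 'n)) set" where "K = {q. ($) q \<in> flows \<nu> E}"
  have K_eq: "K = (\<Inter>e. {q. 0 \<le> q $ e}) \<inter> (\<Inter>e\<in>- E. {q. q $ e = 0}) \<inter>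
      (\<Inter>j. {q. (\<Sum>i\<in>UNIV. q $ (i, j)) = \<nu> $ j})"
    by (auto simp: K_def flows_def)
  have "closed K"
    unfolding K_eq
    by (intro closed_Int closed_INT ballI closed_Collect_le closed_Collect_eq continuous_intros)
  moreover have "norm q \<le> (\<Sum>j\<in>UNIV. \<nu> $ j)" if "q \<in> K" for q
  proof -
    have "norm q \<le> (\<Sum>e\<in>UNIV. \<bar>q $ e\<bar>)" by (rule norm_le_l1_cart)
    also have "\<dots> = (\<Sum>e\<in>UNIV. q $ e)" using flows_nonneg that by (fastforce simp: K_def intro!: sum.cong)
    also have "\<dots> = (\<Sum>j\<in>UNIV. \<Sum>i\<in>UNIV. q $ (i, j))" by (rule sum_pairs_iterated)
    also have "\<dots> = (\<Sum>j\<in>UNIV. \<nu> $ j)" using that by (simp add: K_def flows_def)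
    finally show ?thesis .
  qed
  ultimately have "compact K" by (auto simp: compact_eq_bounded_closed bounded_iff)
  moreover have "K \<noteq> {}"
  proof -
    obtain Q where Q: "Q \<in> flows \<nu> E" using flow_exists[OF assms(2,3)] by blast
    have "($) (\<chi> e. Q e) = Q" by (rule ext) simp
    with Q have "(\<chi> e. Q e) \<in> K" by (simp add: K_def)
    then show ?thesis by blast
  qed
  moreover have "continuous_on K (\<lambda>q. rel_entropy (row_sums (($) q)) \<mu>)"
    unfolding rel_entropy_def row_sums_def vec_lambda_beta
    by (intro continuous_on_sum continuous_on_compose2[OF entropy_term_continuous] continuous_intros)
      (auto simp: assms(1) K_def flows_def intro!: sum_nonneg)
  ultimately obtain q where q: "q \<in> K"
    "\<And>q'. q' \<in> K \<Longrightarrow> rel_entropy (row_sums (($) q)) \<mu> \<le> rel_entropy (row_sums (($) q')) \<mu>"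
    using continuous_attains_inf[of K "\<lambda>q. rel_entropy (row_sums (($) q)) \<mu>"] by blast
  show thesis
  proof (rule that)
    show "($) q \<in> flows \<nu> E" using q(1) by (simp add: K_def)
    fix Q' assume Q': "Q' \<in> flows \<nu> E"
    have eq: "($) (\<chi> e. Q' e) = Q'" by (rule ext) simp
    with Q' have "(\<chi> e. Q' e) \<in> K" by (simp add: K_def)
    from q(2)[OF this] show "rel_entropy (row_sums (($) q)) \<mu> \<le> rel_entropy (row_sums Q') \<mu>"
      by (simp only: eq)
  qed
qed

text \<open>
  First-order optimality. Let \<open>x\<close> be the row sums of an optimal flow. Moving mass \<open>\<epsilon>\<close> from the used
  edge \<open>(i, j)\<close> to another edge \<open>(k, j)\<close> at the same column keeps the flow feasible and changes the
  entropy at rate \<open>ln (x k / \<mu> k) - ln (x i / \<mu> i)\<close>, so the ratio at \<open>k\<close> cannot be the smaller one.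
  Applied at \<open>x k = 0\<close>, this also shows that the optimal row sums are positive.

  No derivative is taken: the tangents at the two perturbed row sums bound the old entropy from below,
  and these tangents exist even where the old row sum is \<open>0\<close>.
\<close>
lemma optimal_flow_ratio_mono:
  fixes \<mu> :: "real ^ 'm::finite" and \<nu> :: "real ^ 'n::finite" and E :: "('m \<times> 'n) set"
  assumes \<mu>: "\<forall>i. 0 < \<mu> $ i" and Q: "Q \<in> flows \<nu> E"
    and opt: "\<And>Q'. Q' \<in> flows \<nu> E \<Longrightarrow> rel_entropy (row_sums Q) \<mu> \<le> rel_entropy (row_sums Q') \<mu>"
    and pos: "0 < Q (i, j)" and edge: "(k, j) \<in> E"
  shows "row_sums Q $ i / \<mu> $ i \<le> row_sums Q $ k / \<mu> $ k"
proof (rule ccontr)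
  assume neg: "\<not> ?thesis"
  then have ik: "i \<noteq> k" by auto
  let ?x = "row_sums Q"
  have x0: "0 \<le> ?x $ a" for a using Q by (auto simp: flows_def row_sums_def intro!: sum_nonneg)
  have ij: "(i, j) \<in> E" using Q pos by (force simp: flows_def)
  have mi: "0 < \<mu> $ i" and mk: "0 < \<mu> $ k" using \<mu> by auto
  define d where "d = ?x $ i * \<mu> $ k - ?x $ k * \<mu> $ i"
  have d: "0 < d" using neg mi mk by (simp add: d_def field_simps)
  \<comment> \<open>Half of the amount that would make the two ratios equal, and no more than the mass available.\<close>
  define \<epsilon> where "\<epsilon> = min (Q (i, j)) (d / (2 * (\<mu> $ i + \<mu> $ k)))"
  have \<epsilon>: "0 < \<epsilon>" "\<epsilon> \<le> Q (i, j)" using pos d mi mk by (auto simp: \<epsilon>_def)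
  have "\<epsilon> * (\<mu> $ i + \<mu> $ k) \<le> d / (2 * (\<mu> $ i + \<mu> $ k)) * (\<mu> $ i + \<mu> $ k)"
    using mi mk by (intro mult_right_mono) (auto simp: \<epsilon>_def)
  also have "\<dots> = d / 2" using mi mk by (simp add: field_simps)
  finally have "\<epsilon> * (\<mu> $ i + \<mu> $ k) < d" using d by simp
  then have lt: "(?x $ k + \<epsilon>) / \<mu> $ k < (?x $ i - \<epsilon>) / \<mu> $ i"
    using mi mk by (simp add: d_def field_simps)
  have pk: "0 < (?x $ k + \<epsilon>) / \<mu> $ k" using mk \<epsilon>(1) x0[of k] by simp
  have "0 < (?x $ i - \<epsilon>) / \<mu> $ i" using pk lt by (rule less_trans)
  then have pi: "0 < ?x $ i - \<epsilon>" using mi by (simp add: zero_less_divide_iff)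
  define Q' where "Q' = (\<lambda>e. Q e + (if e = (k, j) then \<epsilon> else 0) - (if e = (i, j) then \<epsilon> else 0))"
  have "Q' \<in> flows \<nu> E"
    unfolding flows_def mem_Collect_eq
  proof (intro conjI allI impI)
    show "0 \<le> Q' e" for e using flows_nonneg[OF Q, of e] \<epsilon> ik by (auto simp: Q'_def)
    show "Q' e = 0" if "e \<notin> E" for e using flows_support[OF Q, of e] that edge ij by (auto simp: Q'_def)
    show "(\<Sum>a\<in>UNIV. Q' (a, b)) = \<nu> $ b" for b
      using Q by (cases "b = j") (simp_all add: Q'_def flows_def sum.distrib sum_subtractf)
  qed
  then have le: "rel_entropy ?x \<mu> \<le> rel_entropy (row_sums Q') \<mu>" by (rule opt)
  have x': "row_sums Q' $ a = ?x $ a + (if a = k then \<epsilon> else 0) - (if a = i then \<epsilon> else 0)" for a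
    by (simp add: row_sums_def Q'_def sum.distrib sum_subtractf)
  let ?A = "(ln ((?x $ i - \<epsilon>) / \<mu> $ i) + 1) * \<epsilon>"
  let ?B = "- ((ln ((?x $ k + \<epsilon>) / \<mu> $ k) + 1) * \<epsilon>)"
  \<comment> \<open>\<open>?A\<close> and \<open>?B\<close> are the increments along the tangents at the two changed row sums.\<close>
  have "rel_entropy (row_sums Q') \<mu> + ?A + ?B =
    (\<Sum>a\<in>UNIV. row_sums Q' $ a * ln (row_sums Q' $ a / \<mu> $ a) +
       (if a = i then ?A else 0) + (if a = k then ?B else 0))"
    by (simp add: rel_entropy_def sum.distrib)
  also have "\<dots> \<le> rel_entropy ?x \<mu>"
    unfolding rel_entropy_def
  proof (rule sum_mono)
    fix a
    show "row_sums Q' $ a * ln (row_sums Q' $ a / \<mu> $ a) +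
       (if a = i then ?A else 0) + (if a = k then ?B else 0) \<le> ?x $ a * ln (?x $ a / \<mu> $ a)"
      using entropy_term_tangent(1)[OF mi x0[of i] pi]
        entropy_term_tangent(1)[OF mk x0[of k], of "?x $ k + \<epsilon>"] x0[of k] \<epsilon>(1) ik
      by (cases "a = i"; cases "a = k") (simp_all add: x')
  qed
  finally have "?A + ?B \<le> 0" using le by linarith
  moreover have "?A + ?B = \<epsilon> * (ln ((?x $ i - \<epsilon>) / \<mu> $ i) - ln ((?x $ k + \<epsilon>) / \<mu> $ k))"
    by (simp add: algebra_simps)
  moreover have "0 < ln ((?x $ i - \<epsilon>) / \<mu> $ i) - ln ((?x $ k + \<epsilon>) / \<mu> $ k)"
    using ln_less_cancel_iff[OF pk less_trans[OF pk lt]] lt by simp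
  ultimately show False using mult_pos_pos[OF \<epsilon>(1)] by (metis not_less)
qed

section \<open>Optimality conditions and duality\<close>

text \<open>
  The Karush-Kuhn-Tucker conditions for maximizing the concave function
  \<open>w \<bullet> \<nu> - (\<Sum>i. \<mu> i * exp (- v i))\<close> over the cone of directions with \<open>v i + w j \<le> 0\<close> on \<open>E\<close>. This is
  the dual of minimizing the entropy of the row sums. The flow \<open>Q\<close> is the multiplier: it charges only the constraints
  that hold with equality, and its marginals form the gradient \<open>(\<mu> exp (- v), \<nu>)\<close>. Although this function treats rows and
  columns differently, the conditions are symmetric: \<open>Q (i, j) * exp (v i)\<close> is a multiplier for
  \<open>v \<bullet> \<mu> - (\<Sum>j. \<nu> j * exp (- w j))\<close> at the same \<open>(v, w)\<close>.
\<close>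
definition optimal_slopes ::
  "real ^ 'm \<Rightarrow> real ^ 'n \<Rightarrow> ('m::finite \<times> 'n::finite) set \<Rightarrow>
    real ^ 'm \<Rightarrow> real ^ 'n \<Rightarrow> ('m \<times> 'n \<Rightarrow> real) \<Rightarrow> bool" where
  "optimal_slopes \<mu> \<nu> E v w Q \<longleftrightarrow>
     (\<forall>i j. (i, j) \<in> E \<longrightarrow> v $ i + w $ j \<le> 0) \<and>
     (\<forall>e. 0 \<le> Q e) \<and> (\<forall>i j. Q (i, j) \<noteq> 0 \<longrightarrow> (i, j) \<in> E \<and> v $ i + w $ j = 0) \<and>
     (\<forall>i. (\<Sum>j\<in>UNIV. Q (i, j)) = \<mu> $ i * exp (- v $ i)) \<and>
     (\<forall>j. (\<Sum>i\<in>UNIV. Q (i, j)) = \<nu> $ j)"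

text \<open>
  Take an optimal flow, with row sums \<open>x\<close>, and put \<open>v i = - ln (x i / \<mu> i)\<close>. By first-order
  optimality each column is served only by neighbours with the largest \<open>v\<close>; minus this common value is
  \<open>w\<close> at the column.
\<close>
lemma optimal_slopes_exist:
  fixes \<mu> :: "real ^ 'm::finite" and \<nu> :: "real ^ 'n::finite" and E :: "('m \<times> 'n) set"
  assumes \<mu>: "\<forall>i. 0 < \<mu> $ i" and \<nu>: "\<forall>j. 0 < \<nu> $ j" and E: "no_isolated_vertex E"
  obtains v w Q where "optimal_slopes \<mu> \<nu> E v w Q"
proof -
  obtain Q where Q: "Q \<in> flows \<nu> E" and opt:
    "\<And>Q'. Q' \<in> flows \<nu> E \<Longrightarrow> rel_entropy (row_sums Q) \<mu> \<le> rel_entropy (row_sums Q') \<mu>"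
    using optimal_flow_exists[OF assms] by blast
  let ?x = "row_sums Q"
  have x_eq: "?x $ i = (\<Sum>j\<in>UNIV. Q (i, j))" for i by (simp add: row_sums_def)
  have Q0: "0 \<le> Q e" for e using Q by (rule flows_nonneg)
  have QE: "e \<in> E" if "Q e \<noteq> 0" for e using flows_support[OF Q that] .
  have col: "(\<Sum>i\<in>UNIV. Q (i, j)) = \<nu> $ j" for j using Q by (simp add: flows_def)
  have "\<exists>i. 0 < Q (i, j)" for j
    using col[of j] \<nu> Q0 by (metis less_eq_real_def less_irrefl sum.neutral)
  \<comment> \<open>\<open>s j\<close> is one of the rows that serve the column \<open>j\<close>.\<close>
  then obtain s where s: "\<And>j. 0 < Q (s j, j)" by metis
  have mono: "?x $ i / \<mu> $ i \<le> ?x $ k / \<mu> $ k" if "0 < Q (i, j)" "(k, j) \<in> E" for i j k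
    using optimal_flow_ratio_mono[OF \<mu> Q opt that] .
  have pos_of: "0 < ?x $ i" if "0 < Q (i, j)" for i j
    unfolding x_eq using that Q0 by (intro sum_pos2[where i = j]) auto
  have x_pos: "0 < ?x $ k" for k
  proof -
    obtain j where "(k, j) \<in> E" using E by (auto simp: no_isolated_vertex_def)
    then have "?x $ (s j) / \<mu> $ (s j) \<le> ?x $ k / \<mu> $ k" using mono s by blast
    moreover have "0 < ?x $ (s j) / \<mu> $ (s j)" using pos_of[OF s] \<mu> by simp
    ultimately show ?thesis using \<mu> by (metis less_le_trans zero_less_divide_iff order_less_asym)
  qed
  define v where "v = (\<chi> i. - ln (?x $ i / \<mu> $ i))"
  define w where "w = (\<chi> j. - v $ s j)"
  have v_mono: "v $ k \<le> v $ i" if "0 < Q (i, j)" "(k, j) \<in> E" for i j k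
    using mono[OF that] x_pos \<mu> by (simp add: v_def)
  have "optimal_slopes \<mu> \<nu> E v w Q"
    unfolding optimal_slopes_def
  proof (intro conjI allI impI)
    show "v $ i + w $ j \<le> 0" if "(i, j) \<in> E" for i j
      using v_mono[OF s that] by (simp add: w_def)
    show "v $ i + w $ j = 0" if "Q (i, j) \<noteq> 0" for i j
    proof -
      have "0 < Q (i, j)" using that Q0[of "(i, j)"] by simp
      moreover have "(s j, j) \<in> E" using QE[of "(s j, j)"] s[of j] by simp
      ultimately have "v $ i = v $ s j"
        using v_mono[of i j "s j"] v_mono[OF s QE[OF that]] by simp
      then show ?thesis by (simp add: w_def)
    qed
    show "(\<Sum>j\<in>UNIV. Q (i, j)) = \<mu> $ i * exp (- v $ i)" for i
      using x_pos[of i] \<mu>[rule_format, of i] by (simp add: v_def x_eq)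
  qed (use Q0 QE col in auto)
  then show thesis by (rule that)
qed

text \<open>
  Only the values on edges with mass enter when a function of the row and a function of the column are
  integrated against the same flow. All duality below comes from this.
\<close>
lemma flow_pairing_mono:
  fixes Q :: "'m::finite \<times> 'n::finite \<Rightarrow> real"
  assumes "\<forall>e. 0 \<le> Q e" and "\<forall>i j. Q (i, j) \<noteq> 0 \<longrightarrow> a i \<le> b j"
  shows "(\<Sum>i\<in>UNIV. a i * (\<Sum>j\<in>UNIV. Q (i, j))) \<le> (\<Sum>j\<in>UNIV. b j * (\<Sum>i\<in>UNIV. Q (i, j)))"
proof -
  have "(\<Sum>i\<in>UNIV. a i * (\<Sum>j\<in>UNIV. Q (i, j))) = (\<Sum>i\<in>UNIV. \<Sum>j\<in>UNIV. a i * Q (i, j))"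
    by (simp add: sum_distrib_left)
  also have "\<dots> \<le> (\<Sum>i\<in>UNIV. \<Sum>j\<in>UNIV. b j * Q (i, j))"
    using assms by (intro sum_mono) (metis mult_right_mono mult_zero_right order_refl)
  also have "\<dots> = (\<Sum>j\<in>UNIV. \<Sum>i\<in>UNIV. b j * Q (i, j))" by (rule sum.swap)
  finally show ?thesis by (simp add: sum_distrib_left)
qed

text \<open>
  Complementary slackness: \<open>v i = - w j\<close> wherever \<open>Q\<close> has mass, so integrating either side against \<open>Q\<close>
  gives the same value.
\<close>
lemma optimal_slopes_pairing:
  assumes "optimal_slopes \<mu> \<nu> E v w Q"
  shows "(\<Sum>i\<in>UNIV. v $ i * (\<mu> $ i * exp (- v $ i))) = - (w \<bullet> \<nu>)"
proof -
  have Q: "\<forall>e. 0 \<le> Q e" "\<forall>i j. Q (i, j) \<noteq> 0 \<longrightarrow> v $ i = - w $ j"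
    using assms by (auto simp: optimal_slopes_def add_eq_0_iff)
  have "(\<Sum>i\<in>UNIV. v $ i * (\<Sum>j\<in>UNIV. Q (i, j))) = (\<Sum>j\<in>UNIV. - w $ j * (\<Sum>i\<in>UNIV. Q (i, j)))"
  proof (rule antisym)
    show "(\<Sum>i\<in>UNIV. v $ i * (\<Sum>j\<in>UNIV. Q (i, j))) \<le> (\<Sum>j\<in>UNIV. - w $ j * (\<Sum>i\<in>UNIV. Q (i, j)))"
      using Q by (intro flow_pairing_mono) auto
    have "(\<Sum>i\<in>UNIV. - v $ i * (\<Sum>j\<in>UNIV. Q (i, j))) \<le> (\<Sum>j\<in>UNIV. w $ j * (\<Sum>i\<in>UNIV. Q (i, j)))"
      using Q by (intro flow_pairing_mono) auto
    then show "(\<Sum>j\<in>UNIV. - w $ j * (\<Sum>i\<in>UNIV. Q (i, j))) \<le> (\<Sum>i\<in>UNIV. v $ i * (\<Sum>j\<in>UNIV. Q (i, j)))"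
      by (simp add: sum_negf)
  qed
  then show ?thesis
    using assms by (simp add: optimal_slopes_def inner_vec_def sum_negf)
qed

text \<open>
  On the support of \<open>Q\<close> the factors \<open>exp (v i)\<close> and \<open>exp (- w j)\<close> agree. Multiplying \<open>Q\<close> by this factor
  therefore turns its row sums into \<open>\<mu>\<close> and its column sums into \<open>\<nu> exp (- w)\<close>, which exchanges the roles
  of rows and columns. Every fact about one side thus yields the one about the other side.
\<close>
lemma optimal_slopes_converse:
  assumes "optimal_slopes \<mu> \<nu> E v w Q"
  shows "optimal_slopes \<nu> \<mu> (converse E) w v (\<lambda>(j, i). Q (i, j) * exp (v $ i))"
proof -
  have eq: "Q (i, j) * exp (v $ i) = exp (- w $ j) * Q (i, j)" for i j
    using assms by (cases "Q (i, j) = 0") (auto simp: optimal_slopes_def add_eq_0_iff)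
  have "(\<Sum>i\<in>UNIV. Q (i, j) * exp (v $ i)) = \<nu> $ j * exp (- w $ j)" for j
    unfolding eq using assms by (simp add: optimal_slopes_def flip: sum_distrib_left)
  moreover have "(\<Sum>j\<in>UNIV. Q (i, j) * exp (v $ i)) = \<mu> $ i" for i
    using assms by (simp add: optimal_slopes_def exp_minus flip: sum_distrib_right)
  ultimately show ?thesis
    using assms by (auto simp: optimal_slopes_def add.commute)
qed

text \<open>
  The conditions are sufficient for optimality. The tangent of the entropy at \<open>p = \<mu> exp (- v)\<close> has
  slope \<open>1 - v i\<close> in coordinate \<open>i\<close>. All competitors have the same mass, and by weak duality none has a
  larger \<open>v\<close>-average than \<open>p\<close>; strict convexity then excludes every other minimizer.
\<close>
lemma mu_star_eq:
  fixes \<mu> :: "real ^ 'm::finite" and \<nu> :: "real ^ 'n::finite"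
  assumes \<mu>: "\<forall>i. 0 < \<mu> $ i" and \<nu>: "\<nu> \<in> prob_simplex" and cert: "optimal_slopes \<mu> \<nu> E v w Q"
  shows "mu_star \<mu> \<nu> E = (\<chi> i. \<mu> $ i * exp (- v $ i))"
proof -
  define p where "p = (\<chi> i. \<mu> $ i * exp (- v $ i))"
  have Q: "Q \<in> flows \<nu> E" and row: "row_sums Q = p"
    using cert by (auto simp: optimal_slopes_def flows_def row_sums_def p_def)
  have p_pos: "0 < p $ i" for i using \<mu> by (simp add: p_def)
  have ln_p: "ln (p $ i / \<mu> $ i) = - v $ i" for i using \<mu>[rule_format, of i] by (simp add: p_def)
  have less: "rel_entropy p \<mu> < rel_entropy p' \<mu>" if Q': "Q' \<in> flows \<nu> E" "p' = row_sums Q'" "p' \<noteq> p" for Q' p'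
  proof -
    have p'0: "0 \<le> p' $ i" for i
      using Q' by (auto simp: flows_def row_sums_def intro!: sum_nonneg)
    have mass: "sum (\<lambda>i. row_sums R $ i) UNIV = sum (($) \<nu>) UNIV" if "R \<in> flows \<nu> E" for R
      using that sum_pairs_iterated[of R] by (simp add: flows_def row_sums_def)
    have "(\<Sum>i\<in>UNIV. v $ i * p' $ i) \<le> (\<Sum>i\<in>UNIV. v $ i * p $ i)"
    proof -
      have "(\<Sum>i\<in>UNIV. v $ i * (\<Sum>j\<in>UNIV. Q' (i, j))) \<le> (\<Sum>j\<in>UNIV. - w $ j * (\<Sum>i\<in>UNIV. Q' (i, j)))"
      proof (rule flow_pairing_mono)
        show "\<forall>e. 0 \<le> Q' e" using Q' by (simp add: flows_def)
        show "\<forall>i j. Q' (i, j) \<noteq> 0 \<longrightarrow> v $ i \<le> - w $ j"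
          using Q' cert by (fastforce simp: flows_def optimal_slopes_def)
      qed
      also have "\<dots> = - (w \<bullet> \<nu>)"
        using Q' by (simp add: flows_def inner_vec_def sum_negf)
      finally show ?thesis
        using optimal_slopes_pairing[OF cert] Q'(2) by (simp add: row_sums_def p_def)
    qed
    then have "rel_entropy p \<mu> \<le> rel_entropy p \<mu> + (\<Sum>i\<in>UNIV. (1 - v $ i) * (p' $ i - p $ i))"
      using mass[OF Q] mass[OF Q'(1)] Q'(2) row
      by (simp add: left_diff_distrib right_diff_distrib sum_subtractf)
    also have "\<dots> = (\<Sum>i\<in>UNIV. p $ i * ln (p $ i / \<mu> $ i) + (ln (p $ i / \<mu> $ i) + 1) * (p' $ i - p $ i))"
      unfolding ln_p rel_entropy_def sum.distrib[symmetric]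
      by (intro sum.cong) (auto simp: algebra_simps)
    also have "\<dots> < rel_entropy p' \<mu>"
    proof -
      obtain k where "p' $ k \<noteq> p $ k" using Q'(3) by (auto simp: vec_eq_iff)
      then show ?thesis
        unfolding rel_entropy_def
        using entropy_term_tangent(1)[OF \<mu>[rule_format] p'0 p_pos]
          entropy_term_tangent(2)[OF \<mu>[rule_format] p'0 p_pos, of k k k]
        by (intro sum_strict_mono_ex1) (auto intro!: bexI[of _ k])
    qed
    finally show ?thesis .
  qed
  have "mu_star \<mu> \<nu> E = p"
    unfolding mu_star_eq_flows[OF \<nu>]
  proof (rule the_equality)
    show "is_arg_min (\<lambda>p. rel_entropy p \<mu>) (\<lambda>p. p \<in> row_sums ` flows \<nu> E) p"
      using Q row less unfolding is_arg_min_def by (metis image_iff order_less_asym order_less_irrefl)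
    show "q = p" if "is_arg_min (\<lambda>p. rel_entropy p \<mu>) (\<lambda>p. p \<in> row_sums ` flows \<nu> E) q" for q
      using that Q row less unfolding is_arg_min_def by (metis image_iff)
  qed
  then show ?thesis by (simp add: p_def)
qed

lemma nu_star_eq:
  fixes \<mu> :: "real ^ 'm::finite" and \<nu> :: "real ^ 'n::finite"
  assumes "\<mu> \<in> prob_simplex" and "\<forall>j. 0 < \<nu> $ j" and "optimal_slopes \<mu> \<nu> E v w Q"
  shows "nu_star \<mu> \<nu> E = (\<chi> j. \<nu> $ j * exp (- w $ j))"
  unfolding nu_star_eq_mu_star_converse
  using mu_star_eq[OF assms(2,1) optimal_slopes_converse[OF assms(3)]] .

text \<open>
  One entropy of each pair is evaluated from its definition, as \<open>ln (\<mu> / \<mu>\<^sup>*) = v\<close>. For the other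
  one, complementary slackness moves the average of \<open>v\<close> under \<open>\<mu>\<^sup>*\<close> to the average of \<open>- w\<close> under \<open>\<nu>\<close>. Hence
  the two entropies of \<open>\<mu>\<close> and \<open>\<mu>\<^sup>*\<close> need not agree, but each one equals an entropy of \<open>\<nu>\<close> and \<open>\<nu>\<^sup>*\<close> with
  the arguments in the opposite order.
\<close>
lemma optimal_slopes_entropies:
  fixes \<mu> :: "real ^ 'm::finite" and \<nu> :: "real ^ 'n::finite"
  assumes \<mu>: "\<mu> \<in> prob_simplex" "\<forall>i. 0 < \<mu> $ i" and \<nu>: "\<nu> \<in> prob_simplex" "\<forall>j. 0 < \<nu> $ j"
    and cert: "optimal_slopes \<mu> \<nu> E v w Q"
  shows "v_star \<mu> \<nu> E = v" and "w_star \<mu> \<nu> E = w"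
    and "rel_entropy \<mu> (mu_star \<mu> \<nu> E) = v \<bullet> \<mu>" and "rel_entropy \<nu> (nu_star \<mu> \<nu> E) = w \<bullet> \<nu>"
    and "rel_entropy (mu_star \<mu> \<nu> E) \<mu> = w \<bullet> \<nu>" and "rel_entropy (nu_star \<mu> \<nu> E) \<nu> = v \<bullet> \<mu>"
proof -
  note mu = mu_star_eq[OF \<mu>(2) \<nu>(1) cert]
  note nu = nu_star_eq[OF \<mu>(1) \<nu>(2) cert]
  have \<mu>n: "\<mu> $ i \<noteq> 0" for i using \<mu>(2) by (metis less_irrefl)
  have \<nu>n: "\<nu> $ j \<noteq> 0" for j using \<nu>(2) by (metis less_irrefl)
  have ratio: "ln (a / (a * exp (- x))) = x" "ln (a * exp (- x) / a) = - x" if "a \<noteq> 0" for a x :: real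
  proof -
    have "a / (a * exp (- x)) = exp x" using that by (simp add: exp_minus field_simps)
    then show "ln (a / (a * exp (- x))) = x" by simp
    show "ln (a * exp (- x) / a) = - x" using that by simp
  qed
  show "v_star \<mu> \<nu> E = v"
    by (simp only: v_star_def mu vec_eq_iff vec_lambda_beta ratio[OF \<mu>n]) simp
  show "w_star \<mu> \<nu> E = w"
    by (simp only: w_star_def nu vec_eq_iff vec_lambda_beta ratio[OF \<nu>n]) simp
  show "rel_entropy \<mu> (mu_star \<mu> \<nu> E) = v \<bullet> \<mu>"
    by (simp only: rel_entropy_def mu vec_lambda_beta ratio[OF \<mu>n]) (simp add: inner_vec_def mult.commute)
  show "rel_entropy \<nu> (nu_star \<mu> \<nu> E) = w \<bullet> \<nu>"
    by (simp only: rel_entropy_def nu vec_lambda_beta ratio[OF \<nu>n]) (simp add: inner_vec_def mult.commute)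
  show "rel_entropy (mu_star \<mu> \<nu> E) \<mu> = w \<bullet> \<nu>"
    using optimal_slopes_pairing[OF cert]
    by (simp only: rel_entropy_def mu vec_lambda_beta ratio[OF \<mu>n]) (simp add: sum_negf mult.commute)
  show "rel_entropy (nu_star \<mu> \<nu> E) \<nu> = v \<bullet> \<mu>"
    using optimal_slopes_pairing[OF optimal_slopes_converse[OF cert]]
    by (simp only: rel_entropy_def nu vec_lambda_beta ratio[OF \<nu>n]) (simp add: sum_negf mult.commute)
qed

section \<open>Comparison of slopes for different edge sets\<close>

lemma optimal_slopes_mass:
  fixes \<mu> :: "real ^ 'm::finite" and \<nu> :: "real ^ 'n::finite"
  assumes "\<nu> \<in> prob_simplex" and "optimal_slopes \<mu> \<nu> E v w Q"
  shows "(\<Sum>i\<in>UNIV. \<mu> $ i * exp (- v $ i)) = 1"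
  using assms sum_pairs_iterated[of Q] by (simp add: prob_simplex_def optimal_slopes_def)

text \<open>
  Optimal slopes also beat directions that satisfy the constraints only on the support of \<open>Q\<close>, where
  the multiplier lives. Weak duality bounds \<open>w' \<bullet> \<nu>\<close> by minus the average of \<open>v'\<close> under \<open>p = \<mu> exp (- v)\<close>,
  and \<open>1 + u \<le> exp u\<close> with \<open>u = v - v'\<close> shows that, among normalized \<open>v'\<close>, this average is smallest at
  \<open>v\<close> and only there.
\<close>
lemma optimal_slopes_maximal:
  fixes \<mu> :: "real ^ 'm::finite" and \<nu> :: "real ^ 'n::finite"
  assumes \<mu>: "\<forall>i. 0 < \<mu> $ i" and \<nu>: "\<nu> \<in> prob_simplex" and cert: "optimal_slopes \<mu> \<nu> E v w Q"
    and tangent: "\<forall>i j. Q (i, j) \<noteq> 0 \<longrightarrow> v' $ i + w' $ j \<le> 0"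
    and mass: "(\<Sum>i\<in>UNIV. \<mu> $ i * exp (- v' $ i)) = 1"
  shows "w' \<bullet> \<nu> \<le> w \<bullet> \<nu>" and "v' \<noteq> v \<Longrightarrow> w' \<bullet> \<nu> < w \<bullet> \<nu>"
proof -
  let ?p = "\<lambda>i. \<mu> $ i * exp (- v $ i)"
  have p_pos: "0 < ?p i" for i using \<mu> by simp
  have "(\<Sum>i\<in>UNIV. v' $ i * (\<Sum>j\<in>UNIV. Q (i, j))) \<le> (\<Sum>j\<in>UNIV. - w' $ j * (\<Sum>i\<in>UNIV. Q (i, j)))"
  proof (rule flow_pairing_mono)
    show "\<forall>e. 0 \<le> Q e" using cert by (simp add: optimal_slopes_def del: split_paired_All)
    show "\<forall>i j. Q (i, j) \<noteq> 0 \<longrightarrow> v' $ i \<le> - w' $ j"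
    proof (intro allI impI)
      fix i j assume "Q (i, j) \<noteq> 0"
      with tangent have "v' $ i + w' $ j \<le> 0" by blast
      then show "v' $ i \<le> - w' $ j" by linarith
    qed
  qed
  then have A: "w' \<bullet> \<nu> \<le> - (\<Sum>i\<in>UNIV. v' $ i * ?p i)"
    using cert by (simp add: optimal_slopes_def inner_vec_def sum_negf)
  have B: "w \<bullet> \<nu> = - (\<Sum>i\<in>UNIV. v $ i * ?p i)"
    using optimal_slopes_pairing[OF cert] by simp
  have exp_p: "?p i * exp (v $ i - v' $ i) = \<mu> $ i * exp (- v' $ i)" for i
    by (simp add: mult.assoc flip: exp_add)
  have tangent_sum: "(\<Sum>i\<in>UNIV. ?p i * (1 + (v $ i - v' $ i))) =
      1 + (\<Sum>i\<in>UNIV. v $ i * ?p i) - (\<Sum>i\<in>UNIV. v' $ i * ?p i)"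
    using optimal_slopes_mass[OF \<nu> cert]
    by (simp add: algebra_simps sum.distrib sum_subtractf)
  have le: "?p i * (1 + (v $ i - v' $ i)) \<le> ?p i * exp (v $ i - v' $ i)" for i
    using p_pos[of i] by (intro mult_left_mono exp_ge_add_one_self) simp
  have "(\<Sum>i\<in>UNIV. ?p i * (1 + (v $ i - v' $ i))) \<le> (\<Sum>i\<in>UNIV. ?p i * exp (v $ i - v' $ i))"
    using le by (intro sum_mono)
  then show "w' \<bullet> \<nu> \<le> w \<bullet> \<nu>"
    using A B tangent_sum mass unfolding exp_p by linarith
  assume "v' \<noteq> v"
  then obtain k where "v' $ k \<noteq> v $ k" by (auto simp: vec_eq_iff)
  then have k: "v $ k - v' $ k \<noteq> 0" by simp
  have "1 + (v $ k - v' $ k) \<noteq> exp (v $ k - v' $ k)"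
    using k ln_eq_minus_one[of "exp (v $ k - v' $ k)"] by auto
  then have "?p k * (1 + (v $ k - v' $ k)) < ?p k * exp (v $ k - v' $ k)"
    using le[of k] p_pos[of k] by (simp add: less_le)
  then have "(\<Sum>i\<in>UNIV. ?p i * (1 + (v $ i - v' $ i))) < (\<Sum>i\<in>UNIV. ?p i * exp (v $ i - v' $ i))"
    using le by (intro sum_strict_mono_ex1) auto
  then show "w' \<bullet> \<nu> < w \<bullet> \<nu>"
    using A B tangent_sum mass unfolding exp_p by linarith
qed

text \<open>
  The reason why no edge set occurs twice. The new slopes are still admissible against the multiplier
  of the old ones, so they cannot do better on either side. They differ from the old ones because an edge that forbids
  the old direction has been added, and the maximizers are unique, so one side gets strictly worse.
\<close>
lemma optimal_rate_decreases:
  fixes \<mu> :: "real ^ 'm::finite" and \<nu> :: "real ^ 'n::finite"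
  assumes \<mu>: "\<mu> \<in> prob_simplex" "\<forall>i. 0 < \<mu> $ i" and \<nu>: "\<nu> \<in> prob_simplex" "\<forall>j. 0 < \<nu> $ j"
    and cert: "optimal_slopes \<mu> \<nu> E v w Q" and cert': "optimal_slopes \<mu> \<nu> E' v' w' Q'"
    and sub: "\<forall>e. Q e \<noteq> 0 \<longrightarrow> e \<in> E'" and new: "(i, j) \<in> E'" "0 < v $ i + w $ j"
  shows "v' \<bullet> \<mu> + w' \<bullet> \<nu> < v \<bullet> \<mu> + w \<bullet> \<nu>"
proof -
  have tangent: "\<forall>i j. Q (i, j) \<noteq> 0 \<longrightarrow> v' $ i + w' $ j \<le> 0"
    using sub cert' by (simp add: optimal_slopes_def)
  then have tangent_converse:
    "\<forall>j i. (\<lambda>(j, i). Q (i, j) * exp (v $ i)) (j, i) \<noteq> 0 \<longrightarrow> w' $ j + v' $ i \<le> 0"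
    by (simp add: add.commute)
  note W = optimal_slopes_maximal[OF \<mu>(2) \<nu>(1) cert tangent optimal_slopes_mass[OF \<nu>(1) cert']]
  note V = optimal_slopes_maximal[OF \<nu>(2) \<mu>(1) optimal_slopes_converse[OF cert] tangent_converse
      optimal_slopes_mass[OF \<mu>(1) optimal_slopes_converse[OF cert']]]
  have "v' $ i + w' $ j \<le> 0" using new cert' by (simp add: optimal_slopes_def)
  with new(2) have "v' \<noteq> v \<or> w' \<noteq> w" by auto
  then show ?thesis using V W by fastforce
qed

text \<open>
  The direction \<open>0\<close> is always admissible, and its rate is \<open>0\<close>.
\<close>
lemma optimal_rate_nonneg:
  fixes \<mu> :: "real ^ 'm::finite" and \<nu> :: "real ^ 'n::finite"
  assumes \<mu>: "\<mu> \<in> prob_simplex" "\<forall>i. 0 < \<mu> $ i" and \<nu>: "\<nu> \<in> prob_simplex" "\<forall>j. 0 < \<nu> $ j"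
    and cert: "optimal_slopes \<mu> \<nu> E v w Q"
  shows "0 \<le> v \<bullet> \<mu> + w \<bullet> \<nu>"
proof -
  have "0 \<le> w \<bullet> \<nu>"
    using optimal_slopes_maximal(1)[OF \<mu>(2) \<nu>(1) cert, of 0 0] \<mu>(1) by (simp add: prob_simplex_def)
  moreover have "0 \<le> v \<bullet> \<mu>"
    using optimal_slopes_maximal(1)[OF \<nu>(2) \<mu>(1) optimal_slopes_converse[OF cert], of 0 0] \<nu>(1)
    by (simp add: prob_simplex_def)
  ultimately show ?thesis by simp
qed

section \<open>Motion until the next constraint becomes tight\<close>

definition tight :: "real ^ 'n ^ 'm \<Rightarrow> real ^ 'm::finite \<Rightarrow> real ^ 'n::finite \<Rightarrow> ('m \<times> 'n) set" where
  "tight C a b = {(i, j). a $ i + b $ j - C $ i $ j = 0}"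

text \<open>
  If every constraint at a vertex were slack, the potential at this vertex alone could be raised by the
  smallest slack.
\<close>
lemma pareto_frontier_no_isolated_vertex:
  fixes a :: "real ^ 'm::finite" and b :: "real ^ 'n::finite"
  assumes "(a, b) \<in> pareto_frontier C"
  shows "no_isolated_vertex (tight C a b)"
proof -
  have feas: "a $ i + b $ j \<le> C $ i $ j" for i j
    using assms by (auto simp: pareto_frontier_def dual_feasible_def)
  have max: "a' = a \<and> b' = b" if "\<forall>i j. a' $ i + b' $ j \<le> C $ i $ j" "\<forall>i. a $ i \<le> a' $ i" "\<forall>j. b $ j \<le> b' $ j" for a' b'
    using assms that by (auto simp: pareto_frontier_def dual_feasible_def)
  have "\<exists>j. (i, j) \<in> tight C a b" for i
  proof (rule ccontr)
    assume no: "\<nexists>j. (i, j) \<in> tight C a b"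
    define d where "d = Min (range (\<lambda>j. C $ i $ j - a $ i - b $ j))"
    have "d \<in> range (\<lambda>j. C $ i $ j - a $ i - b $ j)" unfolding d_def by (intro Min_in) auto
    then obtain j where "d = C $ i $ j - a $ i - b $ j" by auto
    moreover have "a $ i + b $ j - C $ i $ j \<noteq> 0" using no by (auto simp: tight_def)
    ultimately have d: "0 < d" using feas[of i j] by linarith
    have slack: "d \<le> C $ i $ j - a $ i - b $ j" for j unfolding d_def by (intro Min_le) auto
    have le: "a $ i + d + b $ j \<le> C $ i $ j" for j using slack[of j] by linarith
    have "(\<chi> k. if k = i then a $ i + d else a $ k) = a"
      using max[of "\<chi> k. if k = i then a $ i + d else a $ k" b] feas le d by auto
    then show False using d by (auto simp: vec_eq_iff split: if_splits dest: spec[of _ i])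
  qed
  moreover have "\<exists>i. (i, j) \<in> tight C a b" for j
  proof (rule ccontr)
    assume no: "\<nexists>i. (i, j) \<in> tight C a b"
    define d where "d = Min (range (\<lambda>i. C $ i $ j - a $ i - b $ j))"
    have "d \<in> range (\<lambda>i. C $ i $ j - a $ i - b $ j)" unfolding d_def by (intro Min_in) auto
    then obtain i where "d = C $ i $ j - a $ i - b $ j" by auto
    moreover have "a $ i + b $ j - C $ i $ j \<noteq> 0" using no by (auto simp: tight_def)
    ultimately have d: "0 < d" using feas[of i j] by linarith
    have slack: "d \<le> C $ i $ j - a $ i - b $ j" for i unfolding d_def by (intro Min_le) auto
    have le: "a $ i + (b $ j + d) \<le> C $ i $ j" for i using slack[of i] by linarith
    have "(\<chi> k. if k = j then b $ j + d else b $ k) = b"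
      using max[of a "\<chi> k. if k = j then b $ j + d else b $ k"] feas le d by auto
    then show False using d by (auto simp: vec_eq_iff split: if_splits dest: spec[of _ j])
  qed
  ultimately show ?thesis by (simp add: no_isolated_vertex_def)
qed

text \<open>
  There are finitely many constraints, so the set of times at which one of them is violated or met is
  closed, and a finite hitting time is attained.
\<close>
lemma hitting_time_cases:
  fixes C :: "real ^ 'n::finite ^ 'm::finite" and E :: "('m \<times> 'n) set"
    and a v :: "real ^ 'm" and b w :: "real ^ 'n" and s :: real
  defines "l \<equiv> \<lambda>i j r. a $ i + b $ j + (r - s) * (v $ i + w $ j) - C $ i $ j"
  obtains (never) "hitting_time C E s a b v w = \<infinity>"
  | (hit) s' i j where "hitting_time C E s a b v w = ereal s'" "s \<le> s'"
      "(i, j) \<notin> E" "0 \<le> l i j s'"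
      "\<And>r i j. s \<le> r \<Longrightarrow> r < s' \<Longrightarrow> (i, j) \<notin> E \<Longrightarrow> l i j r < 0"
proof -
  define S where "S = {r. s \<le> r \<and> (\<exists>i j. (i, j) \<notin> E \<and> 0 \<le> l i j r)}"
  have sup: "0 \<le> (SUP (i, j)\<in>- E. ereal (l i j r)) \<longleftrightarrow> (\<exists>i j. (i, j) \<notin> E \<and> 0 \<le> l i j r)" for r
  proof (cases "- E = {}")
    case True
    then have "(i, j) \<in> E" for i j by auto
    with True show ?thesis by (simp add: bot_ereal_def)
  next
    case False
    have "(SUP (i, j)\<in>- E. ereal (l i j r)) = Max ((\<lambda>(i, j). ereal (l i j r)) ` (- E))"
      using False by (subst Max_Sup) auto
    then have "0 \<le> (SUP (i, j)\<in>- E. ereal (l i j r)) \<longleftrightarrow> (\<exists>e\<in>- E. 0 \<le> l (fst e) (snd e) r)"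
      using False by (simp add: Max_ge_iff split_beta)
    then show ?thesis by (simp only: split_paired_Bex_Sigma bex_simps Bex_def split_paired_Ex Compl_iff fst_conv snd_conv)
  qed
  have ht: "hitting_time C E s a b v w = (INF r\<in>S. ereal r)"
    unfolding hitting_time_def S_def by (simp only: l_def sup[unfolded l_def])
  show thesis
  proof (cases "S = {}")
    case True
    then show ?thesis using never ht by (simp add: top_ereal_def)
  next
    case False
    have S_eq: "S = {s..} \<inter> (\<Union>e\<in>- E. {r. 0 \<le> l (fst e) (snd e) r})"
      by (auto simp: S_def) force
    have "closed S"
      unfolding S_eq l_def
      by (intro closed_Int closed_UN closed_Collect_le continuous_intros closed_atLeast ballI finite)
    moreover have bdd: "bdd_below S" by (auto simp: S_def bdd_below_def)
    ultimately have in_S: "Inf S \<in> S" using closed_contains_Inf[OF False] by blast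
    then obtain i j where ij: "(i, j) \<notin> E" "0 \<le> l i j (Inf S)" "s \<le> Inf S" by (auto simp: S_def)
    have "hitting_time C E s a b v w = ereal (Inf S)"
      unfolding ht using ereal_Inf'[OF bdd False] by simp
    moreover have "l i j r < 0" if "s \<le> r" "r < Inf S" "(i, j) \<notin> E" for r i j
    proof (rule ccontr)
      assume "\<not> l i j r < 0"
      then have "0 \<le> l i j r" by simp
      with that have "r \<in> S" unfolding S_def by blast
      then show False using cInf_lower[OF _ bdd] that(2) by fastforce
    qed
    ultimately show ?thesis using hit ij by blast
  qed
qed

text \<open>
  Constraints outside \<open>E\<close> are strictly slack at time \<open>s\<close>, so the first of them is met later than \<open>s\<close>, and only
  if its slack decreases. Constraints in \<open>E\<close> are preserved because the direction does not increase them.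
\<close>
lemma hitting_time_new_edge:
  fixes C :: "real ^ 'n::finite ^ 'm::finite" and E :: "('m \<times> 'n) set"
  assumes feas: "(a, b) \<in> dual_feasible C" and E: "E = tight C a b"
    and descent: "\<forall>i j. (i, j) \<in> E \<longrightarrow> v $ i + w $ j \<le> 0"
  shows "ereal s < hitting_time C E s a b v w"
    and "hitting_time C E s a b v w = ereal s' \<Longrightarrow>
      (a + (s' - s) *\<^sub>R v, b + (s' - s) *\<^sub>R w) \<in> dual_feasible C \<and>
      (\<exists>i j. (i, j) \<in> tight C (a + (s' - s) *\<^sub>R v) (b + (s' - s) *\<^sub>R w) \<and> 0 < v $ i + w $ j)"
proof -
  let ?l = "\<lambda>i j r. a $ i + b $ j + (r - s) * (v $ i + w $ j) - C $ i $ j"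
  have out: "?l i j s < 0" if "(i, j) \<notin> E" for i j
  proof -
    have "a $ i + b $ j \<le> C $ i $ j" using feas by (simp add: dual_feasible_def)
    moreover have "a $ i + b $ j - C $ i $ j \<noteq> 0" using that by (simp add: E tight_def)
    ultimately show ?thesis by simp
  qed
  have "ereal s < hitting_time C E s a b v w \<and> (hitting_time C E s a b v w = ereal s' \<longrightarrow>
      (a + (s' - s) *\<^sub>R v, b + (s' - s) *\<^sub>R w) \<in> dual_feasible C \<and>
      (\<exists>i j. (i, j) \<in> tight C (a + (s' - s) *\<^sub>R v) (b + (s' - s) *\<^sub>R w) \<and> 0 < v $ i + w $ j))"
  proof (cases rule: hitting_time_cases[of C E s a b v w])
    case never
    then show ?thesis by simp
  next
    case (hit s1 i j)
    have s1: "s < s1" using hit(2,4) out[OF hit(3)] by (cases "s = s1") auto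
    have line: "(a + (s1 - s) *\<^sub>R v) $ i + (b + (s1 - s) *\<^sub>R w) $ j - C $ i $ j = ?l i j s1" for i j
      by (simp add: algebra_simps)
    have le: "?l i j s1 \<le> 0" for i j
    proof (cases "(i, j) \<in> E")
      case True
      have "(s1 - s) * (v $ i + w $ j) \<le> 0"
        using descent True s1 by (intro mult_nonneg_nonpos) auto
      moreover have "a $ i + b $ j \<le> C $ i $ j" using feas by (simp add: dual_feasible_def)
      ultimately show ?thesis by linarith
    next
      case False
      \<comment> \<open>The slack is positive strictly before the hitting time; pass to the limit.\<close>
      have "(?l i j \<longlongrightarrow> ?l i j s1) (at_left s1)" by (intro tendsto_intros)
      moreover have "eventually (\<lambda>r. ?l i j r \<le> 0) (at_left s1)"
        using eventually_at_left_real[OF s1] hit(5)[OF _ _ False]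
        by (auto elim!: eventually_mono intro: less_imp_le)
      ultimately show ?thesis by (rule tendsto_upperbound) simp
    qed
    have "(i, j) \<in> tight C (a + (s1 - s) *\<^sub>R v) (b + (s1 - s) *\<^sub>R w)"
      using le[of i j] hit(4) line[of i j] by (simp add: tight_def)
    moreover have "0 < v $ i + w $ j"
    proof (rule ccontr)
      assume "\<not> 0 < v $ i + w $ j"
      then have "(s1 - s) * (v $ i + w $ j) \<le> 0" using s1 by (intro mult_nonneg_nonpos) auto
      then show False using out[OF hit(3)] hit(4) by simp
    qed
    moreover have "(a + (s1 - s) *\<^sub>R v, b + (s1 - s) *\<^sub>R w) \<in> dual_feasible C"
      unfolding dual_feasible_def using le[folded line] by simp
    ultimately show ?thesis using hit(1) s1 by auto
  qed
  then show "ereal s < hitting_time C E s a b v w"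
    and "hitting_time C E s a b v w = ereal s' \<Longrightarrow>
      (a + (s' - s) *\<^sub>R v, b + (s' - s) *\<^sub>R w) \<in> dual_feasible C \<and>
      (\<exists>i j. (i, j) \<in> tight C (a + (s' - s) *\<^sub>R v) (b + (s' - s) *\<^sub>R w) \<and> 0 < v $ i + w $ j)"
    by blast+
qed

text \<open>
  Edges that carry mass have \<open>v i + w j = 0\<close>, so their constraints stay tight along the motion; and
  they already meet every vertex because the marginals of \<open>Q\<close> are positive.
\<close>
lemma optimal_slopes_active_edges_stay_tight:
  fixes C :: "real ^ 'n::finite ^ 'm::finite"
  assumes \<mu>: "\<forall>i. 0 < \<mu> $ i" and \<nu>: "\<forall>j. 0 < \<nu> $ j"
    and cert: "optimal_slopes \<mu> \<nu> (tight C a b) v w Q"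
  shows "\<forall>e. Q e \<noteq> 0 \<longrightarrow> e \<in> tight C (a + h *\<^sub>R v) (b + h *\<^sub>R w)"
    and "no_isolated_vertex (tight C (a + h *\<^sub>R v) (b + h *\<^sub>R w))"
proof -
  have stay: "(i, j) \<in> tight C (a + h *\<^sub>R v) (b + h *\<^sub>R w)" if "Q (i, j) \<noteq> 0" for i j
  proof -
    have "a $ i + b $ j - C $ i $ j = 0" "v $ i + w $ j = 0"
      using cert that by (auto simp: optimal_slopes_def tight_def)
    moreover have "h * v $ i + h * w $ j = h * (v $ i + w $ j)" by (simp add: algebra_simps)
    ultimately show ?thesis by (simp add: tight_def)
  qed
  then show "\<forall>e. Q e \<noteq> 0 \<longrightarrow> e \<in> tight C (a + h *\<^sub>R v) (b + h *\<^sub>R w)" by auto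
  have "\<exists>j. Q (i, j) \<noteq> 0" for i
  proof (rule ccontr)
    assume "\<nexists>j. Q (i, j) \<noteq> 0"
    then have "(\<Sum>j\<in>UNIV. Q (i, j)) = 0" by simp
    then have "\<mu> $ i * exp (- v $ i) = 0" using cert by (simp add: optimal_slopes_def)
    then show False using \<mu>[rule_format, of i] by simp
  qed
  moreover have "\<exists>i. Q (i, j) \<noteq> 0" for j
  proof (rule ccontr)
    assume "\<nexists>i. Q (i, j) \<noteq> 0"
    then have "(\<Sum>i\<in>UNIV. Q (i, j)) = 0" by simp
    then have "\<nu> $ j = 0" using cert by (simp add: optimal_slopes_def)
    then show False using \<nu>[rule_format, of j] by simp
  qed
  ultimately show "no_isolated_vertex (tight C (a + h *\<^sub>R v) (b + h *\<^sub>R w))"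
    using stay unfolding no_isolated_vertex_def by blast
qed

lemma affine_of_constant_derivative:
  fixes f :: "real \<Rightarrow> 'a::banach"
  assumes cont: "continuous_on {s..y} f" and "s \<le> y"
    and der: "\<And>r. s \<le> r \<Longrightarrow> r < y \<Longrightarrow> (f has_vector_derivative c) (at r within {s..})"
  shows "f y = f s + (y - s) *\<^sub>R c"
proof -
  let ?h = "\<lambda>r. f r - (r - s) *\<^sub>R c"
  have "?h y = f s"
  proof (rule has_derivative_zero_unique_strong_interval[where f = ?h and a = s and b = y and k = "{y}"])
    show "continuous_on {s..y} ?h" using cont by (intro continuous_intros)
    fix r assume r: "r \<in> {s..y} - {y}"
    then have "(f has_vector_derivative c) (at r within {s..y})"
      using der[of r] by (auto intro: has_vector_derivative_within_subset)
    then have "(?h has_vector_derivative c - 1 *\<^sub>R c) (at r within {s..y})"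
      by (auto intro!: derivative_eq_intros)
    then show "(?h has_derivative (\<lambda>h. 0)) (at r within {s..y})"
      by (simp add: has_vector_derivative_def)
  qed (use \<open>s \<le> y\<close> in auto)
  then show ?thesis by (simp add: algebra_simps)
qed


section \<open>The cold Sinkhorn curve\<close>

definition phase_start ::
  "real ^ 'n ^ 'm \<Rightarrow> (real \<Rightarrow> real ^ 'm::finite) \<Rightarrow> (real \<Rightarrow> real ^ 'n::finite) \<Rightarrow>
    (nat \<Rightarrow> ereal) \<Rightarrow> (nat \<Rightarrow> ('m \<times> 'n) set) \<Rightarrow> nat \<Rightarrow> real \<Rightarrow> bool" where
  "phase_start C f g t E l s \<longleftrightarrow> t l = ereal s \<and> 0 \<le> s \<and> (f s, g s) \<in> dual_feasible C \<and>
     E l = tight C (f s) (g s) \<and> no_isolated_vertex (E l)"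

text \<open>
  The slopes of a phase are constant on the half-open interval only; continuity of the curve carries the
  affine formula to the end of the phase, where the invariant is established again.
\<close>
lemma cold_sinkhorn_phase:
  fixes \<mu> :: "real ^ 'm::finite" and \<nu> :: "real ^ 'n::finite"
  assumes \<mu>: "\<mu> \<in> prob_simplex" "\<forall>i. 0 < \<mu> $ i" and \<nu>: "\<nu> \<in> prob_simplex" "\<forall>j. 0 < \<nu> $ j"
    and cs: "cold_sinkhorn \<mu> \<nu> C f0 g0 f g L t v w E" and l: "enat l \<le> L"
    and start: "phase_start C f g t E l s"
  obtains Q where "optimal_slopes \<mu> \<nu> (E l) (v l) (w l) Q" and "t l < t (Suc l)"
    and "\<And>r. s \<le> r \<Longrightarrow> ereal r \<le> t (Suc l) \<Longrightarrow>
      f r = f s + (r - s) *\<^sub>R v l \<and> g r = g s + (r - s) *\<^sub>R w l"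
    and "\<And>s'. t (Suc l) = ereal s' \<Longrightarrow>
      phase_start C f g t E (Suc l) s' \<and> (\<forall>e. Q e \<noteq> 0 \<longrightarrow> e \<in> E (Suc l)) \<and>
      (\<exists>i j. (i, j) \<in> E (Suc l) \<and> 0 < v l $ i + w l $ j)"
proof -
  have tl: "t l = ereal s" and s: "0 \<le> s" and feas: "(f s, g s) \<in> dual_feasible C"
    and El: "E l = tight C (f s) (g s)" and cov: "no_isolated_vertex (E l)"
    using start by (auto simp: phase_start_def)
  have contf: "continuous_on {0..} f" and contg: "continuous_on {0..} g"
    using cs by (auto simp: cold_sinkhorn_def)
  have vl: "v l = v_star \<mu> \<nu> (E l)" and wl: "w l = w_star \<mu> \<nu> (E l)"
    and ht: "t (Suc l) = hitting_time C (E l) s (f s) (g s) (v l) (w l)"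
    and E_next: "\<And>s'. t (Suc l) = ereal s' \<Longrightarrow>
      E (Suc l) = {(i, j). f s $ i + g s $ j + (s' - s) * (v l $ i + w l $ j) - C $ i $ j = 0}"
    and der: "\<And>r. s \<le> r \<Longrightarrow> ereal r < t (Suc l) \<Longrightarrow>
      (f has_vector_derivative v l) (at r within {s..}) \<and> (g has_vector_derivative w l) (at r within {s..})"
    using cs l tl by (auto simp: cold_sinkhorn_def Let_def)
  obtain v' w' Q where "optimal_slopes \<mu> \<nu> (E l) v' w' Q"
    using optimal_slopes_exist[OF \<mu>(2) \<nu>(2) cov] .
  then have cert: "optimal_slopes \<mu> \<nu> (E l) (v l) (w l) Q"
    using optimal_slopes_entropies(1,2)[OF \<mu> \<nu>] vl wl by metis
  have descent: "\<forall>i j. (i, j) \<in> E l \<longrightarrow> v l $ i + w l $ j \<le> 0"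
    using cert by (simp add: optimal_slopes_def)
  note new = hitting_time_new_edge[OF feas El descent, of s]
  have line: "f r = f s + (r - s) *\<^sub>R v l \<and> g r = g s + (r - s) *\<^sub>R w l"
    if "s \<le> r" "ereal r \<le> t (Suc l)" for r
  proof
    have lt: "ereal x < t (Suc l)" if "x < r" for x
      using that \<open>ereal r \<le> t (Suc l)\<close> by (meson ereal_less(2) less_ereal.simps(1) order_less_le_trans)
    have "continuous_on {s..r} f" "continuous_on {s..r} g"
      using contf contg s by (auto elim!: continuous_on_subset)
    then show "f r = f s + (r - s) *\<^sub>R v l" "g r = g s + (r - s) *\<^sub>R w l"
      using der lt \<open>s \<le> r\<close> by (auto intro!: affine_of_constant_derivative)
  qed
  show thesis
  proof (rule that[OF cert _ line])
    show "t l < t (Suc l)" using new(1) ht tl by simp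
    fix s' assume s': "t (Suc l) = ereal s'"
    then have "s < s'" using new(1) ht by simp
    then have at_s': "f s' = f s + (s' - s) *\<^sub>R v l" "g s' = g s + (s' - s) *\<^sub>R w l"
      using line[of s'] s' by auto
    have E': "E (Suc l) = tight C (f s') (g s')"
      unfolding E_next[OF s'] at_s' tight_def by (simp add: algebra_simps)
    have "hitting_time C (E l) s (f s) (g s) (v l) (w l) = ereal s'" using s' ht by simp
    note hit = new(2)[OF this, folded at_s', folded E']
    note stay = optimal_slopes_active_edges_stay_tight[OF \<mu>(2) \<nu>(2) cert[unfolded El],
        where h = "s' - s", folded at_s', folded E']
    show "phase_start C f g t E (Suc l) s' \<and> (\<forall>e. Q e \<noteq> 0 \<longrightarrow> e \<in> E (Suc l)) \<and>
      (\<exists>i j. (i, j) \<in> E (Suc l) \<and> 0 < v l $ i + w l $ j)"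
      using hit stay s' s \<open>s < s'\<close> E' by (simp add: phase_start_def del: split_paired_All)
  qed
qed

lemma cold_sinkhorn_phase_start:
  fixes \<mu> :: "real ^ 'm::finite" and \<nu> :: "real ^ 'n::finite"
  assumes \<mu>: "\<mu> \<in> prob_simplex" "\<forall>i. 0 < \<mu> $ i" and \<nu>: "\<nu> \<in> prob_simplex" "\<forall>j. 0 < \<nu> $ j"
    and init: "(f0, g0) \<in> pareto_frontier C"
    and cs: "cold_sinkhorn \<mu> \<nu> C f0 g0 f g L t v w E"
  shows "enat l \<le> L \<Longrightarrow> \<exists>s. phase_start C f g t E l s"
proof (induction l)
  case 0
  have "E 0 = tight C (f 0) (g 0)" "t 0 = ereal 0" "f 0 = f0" "g 0 = g0"
    using cs by (auto simp: cold_sinkhorn_def tight_def zero_ereal_def)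
  moreover have "(f0, g0) \<in> dual_feasible C" using init by (simp add: pareto_frontier_def)
  ultimately have "phase_start C f g t E 0 0"
    using pareto_frontier_no_isolated_vertex[OF init] by (simp add: phase_start_def)
  then show ?case ..
next
  case (Suc l)
  then have l: "enat l \<le> L" by (meson Suc_n_not_le_n enat_ord_simps(1) le_cases order_trans)
  then obtain s where s: "phase_start C f g t E l s" using Suc.IH by blast
  obtain Q where "t l < t (Suc l)" and
    next_phase: "\<And>s'. t (Suc l) = ereal s' \<Longrightarrow> phase_start C f g t E (Suc l) s'"
    using cold_sinkhorn_phase[OF \<mu> \<nu> cs l s] by metis
  moreover have "t (Suc l) = \<infinity> \<longrightarrow> L = enat l"
    using cs l by (simp add: cold_sinkhorn_def Let_def)
  then have "t (Suc l) \<noteq> \<infinity>" using Suc.prems by auto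
  ultimately show ?case by (cases "t (Suc l)") auto
qed

text \<open>
  An infinite run could accumulate at a finite time, after which the curve would be unconstrained; this
  is why termination is needed for the monotonicity on the whole half-line. Since the rate depends only on the edge set
  and strictly decreases from phase to phase, an infinite run would produce infinitely many sets of edges.
\<close>
lemma cold_sinkhorn_terminates:
  fixes \<mu> :: "real ^ 'm::finite" and \<nu> :: "real ^ 'n::finite"
  assumes \<mu>: "\<mu> \<in> prob_simplex" "\<forall>i. 0 < \<mu> $ i" and \<nu>: "\<nu> \<in> prob_simplex" "\<forall>j. 0 < \<nu> $ j"
    and init: "(f0, g0) \<in> pareto_frontier C"
    and cs: "cold_sinkhorn \<mu> \<nu> C f0 g0 f g L t v w E"
  shows "L \<noteq> \<infinity>"
proof
  assume inf: "L = \<infinity>"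
  then have le: "enat l \<le> L" for l by simp
  define D where "D l = v l \<bullet> \<mu> + w l \<bullet> \<nu>" for l
  have "D (Suc l) < D l" for l
  proof -
    obtain s where s: "phase_start C f g t E l s"
      using cold_sinkhorn_phase_start[OF assms le] by blast
    obtain s' where s': "phase_start C f g t E (Suc l) s'"
      using cold_sinkhorn_phase_start[OF assms le] by blast
    then have "t (Suc l) = ereal s'" by (simp add: phase_start_def)
    then obtain Q i j where Q: "optimal_slopes \<mu> \<nu> (E l) (v l) (w l) Q" "\<forall>e. Q e \<noteq> 0 \<longrightarrow> e \<in> E (Suc l)"
      and ij: "(i, j) \<in> E (Suc l)" "0 < v l $ i + w l $ j"
      using cold_sinkhorn_phase[OF \<mu> \<nu> cs le s] by metis
    obtain Q' where Q': "optimal_slopes \<mu> \<nu> (E (Suc l)) (v (Suc l)) (w (Suc l)) Q'"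
      using cold_sinkhorn_phase[OF \<mu> \<nu> cs le s'] by metis
    show ?thesis
      unfolding D_def by (rule optimal_rate_decreases[OF \<mu> \<nu> Q(1) Q' Q(2) ij])
  qed
  then have D_less: "D n < D m" if "m < n" for m n
    using that by (rule_tac lift_Suc_mono_less[of "\<lambda>l. - D l", simplified])
  have "inj E"
  proof (rule linorder_injI)
    fix m n :: nat assume "m < n"
    have "v l = v_star \<mu> \<nu> (E l)" "w l = w_star \<mu> \<nu> (E l)" for l
      using cs inf by (auto simp: cold_sinkhorn_def Let_def)
    then have "E m = E n \<Longrightarrow> D m = D n" by (simp add: D_def)
    then show "E m \<noteq> E n" using D_less[OF \<open>m < n\<close>] by auto
  qed
  then have "finite (UNIV :: nat set)" by (rule finite_imageD[rotated]) simp
  then show False by simp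
qed

theorem lemma3p2:
  fixes \<mu> f0 :: "real ^ 'm::finite" and \<nu> g0 :: "real ^ 'n::finite"
    and C :: "real ^ 'n ^ 'm"
    and f :: "real \<Rightarrow> real ^ 'm" and g :: "real \<Rightarrow> real ^ 'n"
    and L :: enat and t :: "nat \<Rightarrow> ereal"
    and v :: "nat \<Rightarrow> real ^ 'm" and w :: "nat \<Rightarrow> real ^ 'n"
    and E :: "nat \<Rightarrow> ('m \<times> 'n) set"
  assumes "\<mu> \<in> prob_simplex" and "\<forall>i. 0 < \<mu> $ i"
    and "\<nu> \<in> prob_simplex" and "\<forall>j. 0 < \<nu> $ j"
    and "(f0, g0) \<in> pareto_frontier C"
    and "cold_sinkhorn \<mu> \<nu> C f0 g0 f g L t v w E"
  shows "antimono_on {0..} (\<lambda>r. Psi0 \<mu> \<nu> (f r) (g r)) \<and>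
    (\<forall>l r. enat l \<le> L \<and> t l \<le> ereal r \<and> ereal r < t (Suc l) \<longrightarrow>
       ((\<lambda>r. Psi0 \<mu> \<nu> (f r) (g r)) has_real_derivative
          - rel_entropy \<mu> (mu_star \<mu> \<nu> (E l)) - rel_entropy \<nu> (nu_star \<mu> \<nu> (E l)))
         (at r within {real_of_ereal (t l)..}) \<and>
       - rel_entropy \<mu> (mu_star \<mu> \<nu> (E l)) - rel_entropy \<nu> (nu_star \<mu> \<nu> (E l))
         = - rel_entropy (mu_star \<mu> \<nu> (E l)) \<mu> - rel_entropy (nu_star \<mu> \<nu> (E l)) \<nu>)"
proof -
  note hyps = assms(1-4) and cs = assms(6)
  let ?\<Psi> = "\<lambda>r. Psi0 \<mu> \<nu> (f r) (g r)"
  note start = cold_sinkhorn_phase_start[OF assms]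
  have "antimono_on {0..} ?\<Psi>"
  proof -
    obtain N where N: "L = enat N" using cold_sinkhorn_terminates[OF assms] by (cases L) auto
    have "t (Suc N) = \<infinity>"
    proof -
      have "enat N \<le> L \<Longrightarrow> t (Suc N) < \<infinity> \<Longrightarrow> enat N < L"
        using cs unfolding cold_sinkhorn_def Let_def by blast
      then show ?thesis using N by auto
    qed
    have step: "?\<Psi> y \<le> ?\<Psi> x"
      if l: "l \<le> N" and t: "t l \<le> ereal x" "x \<le> y" "ereal y \<le> t (Suc l)" for l x y
    proof -
      have l': "enat l \<le> L" using l N by simp
      obtain s where s: "phase_start C f g t E l s" using start[OF l'] by blast
      then have sx: "s \<le> x" using t(1) by (simp add: phase_start_def)
      obtain Q where Q: "optimal_slopes \<mu> \<nu> (E l) (v l) (w l) Q" and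
        line: "\<And>r. s \<le> r \<Longrightarrow> ereal r \<le> t (Suc l) \<Longrightarrow>
          f r = f s + (r - s) *\<^sub>R v l \<and> g r = g s + (r - s) *\<^sub>R w l"
        using cold_sinkhorn_phase[OF hyps cs l' s] by metis
      have "ereal x \<le> t (Suc l)" using t by (meson ereal_less_eq(3) order_trans)
      then have eq: "f x = f s + (x - s) *\<^sub>R v l" "g x = g s + (x - s) *\<^sub>R w l"
          "f y = f s + (y - s) *\<^sub>R v l" "g y = g s + (y - s) *\<^sub>R w l"
        using line[of x] line[of y] sx t by auto
      have "?\<Psi> y = ?\<Psi> x - (y - x) * (v l \<bullet> \<mu> + w l \<bullet> \<nu>)"
        unfolding Psi0_def eq by (simp add: inner_add_left algebra_simps)
      moreover have "0 \<le> (y - x) * (v l \<bullet> \<mu> + w l \<bullet> \<nu>)"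
        using optimal_rate_nonneg[OF hyps Q] t(2) by (intro mult_nonneg_nonneg) auto
      ultimately show ?thesis by linarith
    qed
    have "?\<Psi> y \<le> ?\<Psi> x" if "l \<le> Suc N" "0 \<le> x" "x \<le> y" "ereal y \<le> t l" for l x y
      using that
    proof (induction l arbitrary: x y)
      case 0
      have "t 0 = ereal 0" using cs by (simp add: cold_sinkhorn_def zero_ereal_def)
      with 0 have "x = y" by simp
      then show ?case by simp
    next
      case (Suc l)
      then have l: "l \<le> N" by simp
      then obtain s where s: "t l = ereal s" "0 \<le> s"
        using start[of l] N by (auto simp: phase_start_def)
      consider "y \<le> s" | "s \<le> x" | "x \<le> s" "s \<le> y" by linarith
      then show ?case
      proof cases
        case 1
        then show ?thesis using Suc s by simp
      next
        case 2
        then show ?thesis using step[OF l] Suc.prems s by simp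
      next
        case 3
        then have "?\<Psi> s \<le> ?\<Psi> x" using Suc s by simp
        moreover have "?\<Psi> y \<le> ?\<Psi> s" using step[OF l, of s y] 3 Suc.prems s by simp
        ultimately show ?thesis by (rule order_trans[rotated])
      qed
    qed
    from this[of "Suc N"] \<open>t (Suc N) = \<infinity>\<close> show ?thesis
      by (auto simp: monotone_on_def)
  qed
  moreover have "(?\<Psi> has_real_derivative
          - rel_entropy \<mu> (mu_star \<mu> \<nu> (E l)) - rel_entropy \<nu> (nu_star \<mu> \<nu> (E l)))
         (at r within {real_of_ereal (t l)..}) \<and>
       - rel_entropy \<mu> (mu_star \<mu> \<nu> (E l)) - rel_entropy \<nu> (nu_star \<mu> \<nu> (E l))
         = - rel_entropy (mu_star \<mu> \<nu> (E l)) \<mu> - rel_entropy (nu_star \<mu> \<nu> (E l)) \<nu>"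
    if l: "enat l \<le> L" and r: "t l \<le> ereal r" "ereal r < t (Suc l)" for l r
  proof -
    obtain s where s: "phase_start C f g t E l s" using start[OF l] by blast
    obtain Q where Q: "optimal_slopes \<mu> \<nu> (E l) (v l) (w l) Q"
      using cold_sinkhorn_phase[OF hyps cs l s] by metis
    note H = optimal_slopes_entropies(3-6)[OF hyps Q]
    have "(f has_vector_derivative v l) (at r within {real_of_ereal (t l)..})"
      "(g has_vector_derivative w l) (at r within {real_of_ereal (t l)..})"
      using cs l r by (auto simp: cold_sinkhorn_def Let_def)
    then have "(?\<Psi> has_real_derivative - (v l \<bullet> \<mu>) - w l \<bullet> \<nu>) (at r within {real_of_ereal (t l)..})"
      unfolding Psi0_def has_real_derivative_iff_has_vector_derivative
      by (intro has_vector_derivative_diff has_vector_derivative_minus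
          bounded_linear.has_vector_derivative[OF bounded_linear_inner_left])
    then show ?thesis by (simp add: H)
  qed
  ultimately show ?thesis by blast
qed

end
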